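(* Let $L$ be a language, let $k=k(n)=O(\lg n)$, let $\ell=\ell(n)<k$, and let $p=p(n)\ge 2^{\ell-k}+1/q(n)$ for some polynomial $q$. Suppose there is a randomized polynomial-time algorithm $A$ such that for every $k$ instances $x_1,\ldots,x_k$ of length $n$ there exists a help string $s\in\{0,1\}^{\ell}$ (depending on $x_1,\ldots,x_k$) with $\Pr[A(x_1,\ldots,x_k,s)=(L(x_1),\ldots,L(x_k))]\ge p$. Then $L$ is randomized $k$-membership comparable.
   Context: For a language $L$, $L(x)=1$ if $x\in L$ and $L(x)=0$ otherwise. $L$ is called randomized $k$-membership comparable if there is a randomized algorithm running in time polynomial in $n$ and $k$ and a polynomial $r$ such that for all $k$ instances $x_1,\ldots,x_k$ of length $n$ it outputs $(b_1,\ldots,b_k)\in\{0,1\}^k$ with $\Pr[(b_1,\ldots,b_k)\neq(L(x_1),\ldots,L(x_k))]\ge (1-2^{-k})+1/r(n)$, the probability being only over the algorithm's internal randomness.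
   Formalization: The formal theorem additionally assumes that ℓ(n) is computable in polynomial time from n and k(n) given in unary; for arbitrary ℓ the claim fails (already for k=2, by diagonalizing over the choice of ℓ(n)∈{0,1} and L at each length). *)

theory Defs
  imports "HOL-Probability.Probability" "HOL-Library.Landau_Symbols"
begin

text \<open>
  Randomized algorithms are programs over finitely many registers, each holding a stack of bits;
  every push, pop, coin toss and test costs one unit of time. This is a structured presentation of
  probabilistic multi-stack machines: a tape is a pair of stacks, so the model simulates, and is
  simulated by, probabilistic multitape Turing machines with polynomial overhead.
\<close>

datatype guard = Nonempty nat | Head nat

datatype instr =
    Push nat bool
  | Pop nat
  | Toss nat
  | Branch guard "instr list" "instr list"
  | While guard "instr list"

type_synonym prog = "instr list"
type_synonym store = "nat \<Rightarrow> bool list"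

fun holds :: "guard \<Rightarrow> store \<Rightarrow> bool" where
  "holds (Nonempty r) s \<longleftrightarrow> s r \<noteq> []"
| "holds (Head r) s \<longleftrightarrow> (\<exists>bs. s r = True # bs)"

text \<open>
  A configuration consists of the instructions still to be executed and the store. For a fixed
  program only finitely many instruction lists are reachable, so they act as control states.
\<close>

type_synonym config = "prog \<times> store"

fun step :: "config \<Rightarrow> config pmf" where
  "step ([], s) = return_pmf ([], s)"
| "step (Push r b # cs, s) = return_pmf (cs, s(r := b # s r))"
| "step (Pop r # cs, s) = return_pmf (cs, s(r := tl (s r)))"
| "step (Toss r # cs, s) = map_pmf (\<lambda>b. (cs, s(r := b # s r))) (bernoulli_pmf (1/2))"
| "step (Branch g c d # cs, s) = return_pmf ((if holds g s then c else d) @ cs, s)"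
| "step (While g c # cs, s) =
     return_pmf (if holds g s then (c @ While g c # cs, s) else (cs, s))"

primrec steps :: "nat \<Rightarrow> config \<Rightarrow> config pmf" where
  "steps 0 c = return_pmf c"
| "steps (Suc t) c = bind_pmf (step c) (steps t)"

text \<open>
  The input of an algorithm is a finite list of bit strings, placed in register 0 in a
  self-delimiting code (each bit is preceded by a 1, each string is followed by a 0). A list of
  \<open>k\<close> strings of length \<open>n\<close> has a code of length \<open>k * (2 * n + 1)\<close>.
\<close>

definition encode :: "bool list list \<Rightarrow> bool list" where
  "encode xs = concat (map (\<lambda>x. concat (map (\<lambda>b. [True, b]) x) @ [False]) xs)"

definition init :: "prog \<Rightarrow> bool list list \<Rightarrow> config" where
  "init P xs = (P, (\<lambda>_. [])(0 := encode xs))"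

definition halts_within :: "prog \<Rightarrow> bool list list \<Rightarrow> nat \<Rightarrow> bool" where
  "halts_within P xs t \<longleftrightarrow> (\<forall>c \<in> set_pmf (steps t (init P xs)). fst c = [])"

text \<open>The time bound is worst-case over the coin tosses and holds on every input.\<close>

definition polytime :: "prog \<Rightarrow> bool" where
  "polytime P \<longleftrightarrow>
     (\<exists>t :: nat poly. \<forall>xs. halts_within P xs (poly t (length (encode xs))))"

text \<open>
  The distribution of the final contents of register 0. Halted configurations are fixed by
  \<^const>\<open>step\<close>, so any sufficiently large time would do in place of the least one. The definition is
  meaningful only if such a time exists, in particular if \<^term>\<open>polytime P\<close>.
\<close>

definition result :: "prog \<Rightarrow> bool list list \<Rightarrow> bool list pmf" where
  "result P xs = map_pmf (\<lambda>c. snd c 0) (steps (LEAST t. halts_within P xs t) (init P xs))"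

text \<open>
  \<open>instances m n xs\<close>: \<open>xs\<close> consists of \<open>m\<close> instances, not necessarily distinct, of length \<open>n\<close>.
\<close>

definition instances :: "nat \<Rightarrow> nat \<Rightarrow> bool list list \<Rightarrow> bool" where
  "instances m n xs \<longleftrightarrow> length xs = m \<and> (\<forall>x \<in> set xs. length x = n)"

definition char_vec :: "bool list set \<Rightarrow> bool list list \<Rightarrow> bool list" where
  "char_vec L xs = map (\<lambda>x. x \<in> L) xs"

text \<open>
  The number \<open>k\<close> of instances is a function of their length \<open>n\<close>. By the length of the
  code of the input, \<^term>\<open>polytime P\<close> bounds the running time by a polynomial in \<open>n\<close> and \<open>k n\<close>.
  Every possible output must be a vector of exactly \<open>k n\<close> bits; otherwise an algorithm
  could satisfy the probability bound by printing something that is not a candidate at all.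
\<close>

definition randomized_membership_comparable :: "(nat \<Rightarrow> nat) \<Rightarrow> bool list set \<Rightarrow> bool" where
  "randomized_membership_comparable k L \<longleftrightarrow>
     (\<exists>(P :: prog) (r :: real poly). polytime P \<and> (\<forall>n. 0 < poly r (real n)) \<and>
        (\<forall>n xs. instances (k n) n xs \<longrightarrow>
           (\<forall>b \<in> set_pmf (result P xs). length b = k n) \<and>
           measure_pmf.prob (result P xs) {b. b \<noteq> char_vec L xs}
             \<ge> (1 - 1 / 2 ^ k n) + 1 / poly r (real n)))"

text \<open>
  \<open>l n\<close> is computable, in unary, in polynomial time from \<open>n\<close> and \<open>k n\<close> in unary. Demanding a
  fixed output with probability one amounts to a deterministic algorithm, since the time bound is
  worst-case and the coins may be fixed arbitrarily. For a non-computable \<open>l\<close> an algorithm does not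
  know which length of help strings to use, and help strings of length \<open>l n\<close> then do not in general
  yield membership comparability.
\<close>

definition polytime_computable_given :: "(nat \<Rightarrow> nat) \<Rightarrow> (nat \<Rightarrow> nat) \<Rightarrow> bool" where
  "polytime_computable_given k l \<longleftrightarrow>
     (\<exists>P. polytime P \<and>
        (\<forall>n. result P [replicate n True, replicate (k n) True]
               = return_pmf (replicate (l n) True)))"

end

theory Submission
  imports Defs
begin

text \<open>
  Choose a help string \<open>s\<close> uniformly at random and let \<open>b\<close> be the output of \<open>A\<close> on \<open>s\<close>. The true vector \<open>v\<close>
  satisfies \<open>Pr[b = v] \<ge> p / 2^l \<ge> 1 / 2^k + 1 / (2^l q)\<close>, so \<open>b\<close> hits it more often than a uniform
  vector does. Now draw a uniform vector \<open>r\<close> and output it if \<open>r \<noteq> b\<close>; otherwise output a fresh uniform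
  vector. Then \<open>Pr[output = v] = (1 - Pr[b = v]) / 2^k + 1 / 4^k \<le> 1 / 2^k - 1 / (2^(k + l) q)\<close>. A single
  retry avoids having to sample uniformly from \<open>2^k - 1\<close> vectors, which fair coins cannot do in
  bounded time, and \<open>k = O(log n)\<close> makes \<open>2^(k + l) q\<close> polynomial.
\<close>

section \<open>Execution of programs and relocation of registers\<close>

text \<open>Halted configurations are fixed by \<open>step\<close>, so \<open>T\<close> is any
  sufficient time bound. One equation thus records both halting on all coin tosses and the
  distribution of the final store.\<close>

definition exec :: "prog \<Rightarrow> store \<Rightarrow> nat \<Rightarrow> store pmf \<Rightarrow> bool" where
  "exec c s T D \<longleftrightarrow> steps T (c, s) = map_pmf (Pair []) D"

lemma steps_halted [simp]: "steps t ([], s) = return_pmf ([], s)"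
  by (induction t) (simp_all add: bind_return_pmf)

lemma exec_Nil [simp]: "exec [] s T (return_pmf s') \<longleftrightarrow> s = s'"
  by (auto simp: exec_def)

lemma exec_Suc:
  "exec (Push r b # cs) s (Suc T) D \<longleftrightarrow> exec cs (s(r := b # s r)) T D"
  "exec (Pop r # cs) s (Suc T) D \<longleftrightarrow> exec cs (s(r := tl (s r))) T D"
  "exec (Branch g c d # cs) s (Suc T) D \<longleftrightarrow> exec ((if holds g s then c else d) @ cs) s T D"
  "exec (While g c # cs) s (Suc T) D \<longleftrightarrow> exec (if holds g s then c @ While g c # cs else cs) s T D"
  by (simp_all add: exec_def bind_return_pmf)

lemma exec_numeral [simp]:
  "exec (Push r b # cs) s (numeral v) D \<longleftrightarrow> exec cs (s(r := b # s r)) (pred_numeral v) D"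
  "exec (Pop r # cs) s (numeral v) D \<longleftrightarrow> exec cs (s(r := tl (s r))) (pred_numeral v) D"
  "exec (Branch g c d # cs) s (numeral v) D
     \<longleftrightarrow> exec ((if holds g s then c else d) @ cs) s (pred_numeral v) D"
  "exec (Push r b # cs) s (Suc 0) D \<longleftrightarrow> exec cs (s(r := b # s r)) 0 D"
  "exec (Pop r # cs) s (Suc 0) D \<longleftrightarrow> exec cs (s(r := tl (s r))) 0 D"
  "exec (Branch g c d # cs) s (Suc 0) D \<longleftrightarrow> exec ((if holds g s then c else d) @ cs) s 0 D"
  by (simp_all only: numeral_eq_Suc One_nat_def exec_Suc)

lemma exec_Toss:
  assumes "\<And>b. exec cs (s(r := b # s r)) T (return_pmf (F b))"
  shows "exec (Toss r # cs) s (Suc T) (map_pmf F (bernoulli_pmf (1/2)))"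
  using assms by (simp add: exec_def bind_map_pmf map_pmf_def bind_assoc_pmf bind_return_pmf)

lemma step_append:
  "c \<noteq> [] \<Longrightarrow> step (c @ d, s) = map_pmf (\<lambda>(c', s'). (c' @ d, s')) (step (c, s))"
  by (cases "(c, s)" rule: step.cases) (auto simp: pmf.map_comp o_def)

text \<open>On some coin tosses \<open>c\<close> stops before time \<open>T\<close>, and
  \<open>d\<close> then starts early with time to spare. The spare steps are spent in halted
  configurations and change nothing.\<close>

lemma steps_append:
  assumes "\<forall>x \<in> set_pmf (steps T (c, s)). fst x = []"
    and "\<And>x. x \<in> set_pmf (steps T (c, s)) \<Longrightarrow> \<forall>y \<in> set_pmf (steps T' (d, snd x)). fst y = []"
  shows "steps (T + T') (c @ d, s) = bind_pmf (steps T (c, s)) (\<lambda>x. steps T' (d, snd x))"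
  using assms
proof (induction T arbitrary: c s)
  case 0
  then show ?case by (simp add: bind_return_pmf)
next
  case (Suc T)
  \<comment> \<open>Once all runs have halted, extra time has no effect; this settles the case in
    which \<open>c\<close> is already exhausted.\<close>
  have absorb: "steps (Suc u) x = steps u x" if "\<forall>y \<in> set_pmf (steps u x). fst y = []" for u x
    using that
  proof (induction u arbitrary: x)
    case 0
    then obtain s where "x = ([], s)" by (cases x) auto
    then show ?case by (simp add: bind_return_pmf)
  next
    case (Suc u)
    have "steps (Suc (Suc u)) x = bind_pmf (step x) (steps (Suc u))" by simp
    also have "\<dots> = bind_pmf (step x) (steps u)"
      using Suc by (intro bind_pmf_cong) auto
    finally show ?case by simp
  qed
  have absorb': "steps (v + u) x = steps u x" if "\<forall>y \<in> set_pmf (steps u x). fst y = []" for u v x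
  proof (induction v)
    case (Suc v)
    with that absorb[of "v + u" x] show ?case by (simp del: steps.simps)
  qed simp
  show ?case
  proof (cases "c = []")
    case True
    then show ?thesis
      using Suc.prems(2) absorb'[of T' "(d, s)" "Suc T"] by (simp add: bind_return_pmf del: steps.simps)
  next
    case False
    have "steps (Suc T + T') (c @ d, s) = bind_pmf (step (c, s)) (\<lambda>x. steps (T + T') (fst x @ d, snd x))"
      using False by (simp add: step_append bind_map_pmf case_prod_unfold)
    also have "\<dots> = bind_pmf (step (c, s)) (\<lambda>x. bind_pmf (steps T x) (\<lambda>x. steps T' (d, snd x)))"
    proof (intro bind_pmf_cong refl)
      fix x assume "x \<in> set_pmf (step (c, s))"
      then show "steps (T + T') (fst x @ d, snd x) = bind_pmf (steps T x) (\<lambda>x. steps T' (d, snd x))"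
        using Suc.IH[of "fst x" "snd x"] Suc.prems by (cases x) fastforce
    qed
    finally show ?thesis by (simp add: bind_assoc_pmf)
  qed
qed

lemma exec_append:
  assumes "exec c s T D" and "\<And>s'. s' \<in> set_pmf D \<Longrightarrow> exec d s' T' (E s')"
  shows "exec (c @ d) s (T + T') (bind_pmf D E)"
proof -
  have "steps (T + T') (c @ d, s) = bind_pmf (steps T (c, s)) (\<lambda>x. steps T' (d, snd x))"
    using assms by (intro steps_append) (auto simp: exec_def)
  also have "\<dots> = bind_pmf D (\<lambda>s'. steps T' (d, s'))"
    using assms(1) by (simp add: exec_def bind_map_pmf)
  also have "\<dots> = bind_pmf D (\<lambda>s'. map_pmf (Pair []) (E s'))"
    using assms(2) by (intro bind_pmf_cong) (auto simp: exec_def)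
  finally show ?thesis by (simp add: exec_def map_bind_pmf)
qed

lemma exec_append_det:
  assumes "exec c s T (return_pmf s')" and "exec d s' T' D"
  shows "exec (c @ d) s (T + T') D"
  using exec_append[OF assms(1), of d T' "\<lambda>_. D"] assms(2) by (simp add: bind_return_pmf)

lemma exec_mono: "exec c s T D \<Longrightarrow> T \<le> T' \<Longrightarrow> exec c s T' D"
  using exec_append[of c s T D "[]" "T' - T" return_pmf] by (simp add: bind_return_pmf')

lemma exec_While_False: "\<not> holds g s \<Longrightarrow> s = s' \<Longrightarrow> exec [While g c] s (Suc T) (return_pmf s')"
  by (simp add: exec_Suc)

lemma exec_While_True:
  assumes "holds g s" and "exec c s T D"
    and "\<And>s'. s' \<in> set_pmf D \<Longrightarrow> exec [While g c] s' T' (E s')"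
  shows "exec [While g c] s (Suc (T + T')) (bind_pmf D E)"
  using exec_append[OF assms(2,3)] assms(1) by (simp add: exec_Suc)

lemma exec_While_det:
  assumes "holds g s" and "exec c s T (return_pmf s')" and "exec [While g c] s' T' D"
  shows "exec [While g c] s (Suc (T + T')) D"
  using exec_append_det[OF assms(2,3)] assms(1) by (simp add: exec_Suc)

section \<open>Results and output lengths from execution statements\<close>

definition input_store :: "bool list list \<Rightarrow> store" where
  "input_store xs = (\<lambda>_. [])(0 := encode xs)"

lemma halts_within_if_exec: "exec P (input_store xs) T D \<Longrightarrow> halts_within P xs T"
  by (auto simp: exec_def halts_within_def init_def input_store_def)

lemma exec_if_halts_within:
  assumes "halts_within P xs T"
  obtains D where "exec P (input_store xs) T D"
proof
  have "steps T (init P xs) = map_pmf (\<lambda>x. ([], snd x)) (steps T (init P xs))"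
    using assms map_pmf_cong[of "steps T (init P xs)" "steps T (init P xs)" "\<lambda>x. ([], snd x)" "\<lambda>x. x"]
    by (auto simp: halts_within_def prod_eq_iff)
  then show "exec P (input_store xs) T (map_pmf snd (steps T (init P xs)))"
    by (simp add: exec_def init_def input_store_def pmf.map_comp o_def)
qed

lemma exec_deterministic:
  assumes "exec c s T D" "exec c s T' D'"
  shows "D = D'"
proof -
  have "map_pmf (Pair ([] :: prog)) D = map_pmf (Pair []) D'"
    using exec_mono[OF assms(1), of "T + T'"] exec_mono[OF assms(2), of "T + T'"]
    by (simp add: exec_def)
  then have "map_pmf snd (map_pmf (Pair ([] :: prog)) D) = map_pmf snd (map_pmf (Pair ([] :: prog)) D')"
    by simp
  then show ?thesis by (simp add: pmf.map_comp o_def)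
qed

text \<open>Frees \<open>result\<close> from the least halting time: any time bound determines the
  same final distribution.\<close>

lemma result_eq:
  assumes "exec P (input_store xs) T D"
  shows "result P xs = map_pmf (\<lambda>s. s 0) D"
proof -
  define t where "t = (LEAST t. halts_within P xs t)"
  have "halts_within P xs t"
    unfolding t_def using halts_within_if_exec[OF assms] by (rule LeastI)
  then obtain D' where D': "exec P (input_store xs) t D'"
    by (rule exec_if_halts_within)
  with assms have "D' = D" by (metis exec_deterministic)
  with D' show ?thesis
    by (simp add: result_def exec_def init_def input_store_def pmf.map_comp o_def flip: t_def)
qed

lemma length_step:
  assumes "x \<in> set_pmf (step (c, s))" shows "length (snd x r) \<le> Suc (length (s r))"
  using assms by (cases "(c, s)" rule: step.cases) (auto split: if_splits)

lemma length_steps: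
  "x \<in> set_pmf (steps t y) \<Longrightarrow> length (snd x r) \<le> length (snd y r) + t"
proof (induction t arbitrary: y)
  case (Suc t)
  then obtain z where z: "z \<in> set_pmf (step y)" "x \<in> set_pmf (steps t z)" by auto
  then have "length (snd x r) \<le> length (snd z r) + t" using Suc.IH by blast
  also have "length (snd z r) \<le> Suc (length (snd y r))"
    using z(1) length_step[of z "fst y" "snd y" r] by simp
  finally show ?case by simp
qed simp

text \<open>A step pushes at most one bit. This bounds the output of a subroutine, and hence the
  time of the loops that later traverse it.\<close>

lemma length_exec:
  assumes "exec c s T D" "s' \<in> set_pmf D"
  shows "length (s' r) \<le> length (s r) + T"
  using assms length_steps[of "([], s')" T "(c, s)" r] by (auto simp: exec_def)

section \<open>Running a program on relocated registers\<close>

fun rename_guard :: "(nat \<Rightarrow> nat) \<Rightarrow> guard \<Rightarrow> guard" where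
  "rename_guard f (Nonempty r) = Nonempty (f r)"
| "rename_guard f (Head r) = Head (f r)"

primrec rename :: "(nat \<Rightarrow> nat) \<Rightarrow> instr \<Rightarrow> instr" where
  "rename f (Push r b) = Push (f r) b"
| "rename f (Pop r) = Pop (f r)"
| "rename f (Toss r) = Toss (f r)"
| "rename f (Branch g c d) = Branch (rename_guard f g) (map (rename f) c) (map (rename f) d)"
| "rename f (While g c) = While (rename_guard f g) (map (rename f) c)"

definition overlay :: "(nat \<Rightarrow> nat) \<Rightarrow> store \<Rightarrow> store \<Rightarrow> store" where
  "overlay f u s = (\<lambda>r. if r \<in> range f then u (inv f r) else s r)"

lemma overlay_in [simp]: "inj f \<Longrightarrow> overlay f u s (f r) = u r"
  by (simp add: overlay_def)

lemma overlay_notin [simp]: "r \<notin> range f \<Longrightarrow> overlay f u s r = s r"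
  by (simp add: overlay_def)

lemma overlay_comp [simp]: "inj f \<Longrightarrow> overlay f u s \<circ> f = u"
  by (simp add: fun_eq_iff)

lemma overlay_overlay [simp]: "overlay f u (overlay f w s) = overlay f u s"
  by (simp add: overlay_def fun_eq_iff)

lemma overlay_upd: "inj f \<Longrightarrow> overlay f ((s \<circ> f)(r := x)) s = s(f r := x)"
  by (auto simp: overlay_def fun_eq_iff)

lemma overlay_self: "inj f \<Longrightarrow> overlay f (s \<circ> f) s = s"
  by (auto simp: overlay_def fun_eq_iff)

lemma holds_rename: "holds (rename_guard f g) s \<longleftrightarrow> holds g (s \<circ> f)"
  by (cases g) auto

text \<open>A renamed program sees the store only through \<open>s \<circ> f\<close>. Injectivity
  makes an update of \<open>f r\<close> visible as an update of \<open>r\<close> alone.\<close>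

lemma step_rename:
  assumes "inj f"
  shows "step (map (rename f) c, s)
    = map_pmf (\<lambda>(c', u). (map (rename f) c', overlay f u s)) (step (c, s \<circ> f))"
  using assms
  by (cases "(c, s \<circ> f)" rule: step.cases)
     (auto simp: pmf.map_comp o_def overlay_upd[unfolded o_def] overlay_self[unfolded o_def]
       holds_rename[unfolded o_def])

lemma steps_rename:
  assumes "inj f"
  shows "steps t (map (rename f) c, s)
    = map_pmf (\<lambda>(c', u). (map (rename f) c', overlay f u s)) (steps t (c, s \<circ> f))"
proof (induction t arbitrary: c s)
  case 0
  then show ?case using overlay_self[OF assms, of s] by (simp add: o_def)
next
  case (Suc t)
  show ?case using assms
    by (simp add: step_rename bind_map_pmf map_bind_pmf Suc.IH case_prod_unfold, simp only: comp_def)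
qed

lemma exec_rename:
  assumes "inj f" and "exec c (s \<circ> f) T D"
  shows "exec (map (rename f) c) s T (map_pmf (\<lambda>u. overlay f u s) D)"
  using assms by (simp add: exec_def steps_rename pmf.map_comp o_def)

text \<open>Only register 0 is described, because the remnants in the other registers depend on the
  coins and are of no interest at the end.\<close>

definition computes :: "prog \<Rightarrow> store \<Rightarrow> nat \<Rightarrow> bool list pmf \<Rightarrow> bool" where
  "computes c s T M \<longleftrightarrow> (\<exists>D. exec c s T D \<and> map_pmf (\<lambda>s. s 0) D = M)"

lemma computes_mono: "computes c s T M \<Longrightarrow> T \<le> T' \<Longrightarrow> computes c s T' M"
  unfolding computes_def by (blast intro: exec_mono)

text \<open>The intermediate stores are indexed by the random choice \<open>x\<close>, so that the
  final distribution can be written in terms of \<open>x\<close> instead of being recovered from the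
  store.\<close>

lemma computes_append:
  assumes c: "exec c s T (map_pmf f N)"
    and d: "\<And>x. x \<in> set_pmf N \<Longrightarrow> computes d (f x) T' (M x)"
  shows "computes (c @ d) s (T + T') (bind_pmf N M)"
proof -
  \<comment> \<open>Distinct \<open>x\<close> with the same \<open>f x\<close> have the same \<open>M x\<close>, so one may choose by store.\<close>
  define E where "E s' = (SOME E. exec d s' T' E)" for s'
  have E: "exec d (f x) T' (E (f x)) \<and> map_pmf (\<lambda>s. s 0) (E (f x)) = M x" if x: "x \<in> set_pmf N" for x
  proof -
    obtain E' where E': "exec d (f x) T' E'" "map_pmf (\<lambda>s. s 0) E' = M x"
      using d[OF x] unfolding computes_def by blast
    from E'(1) have "exec d (f x) T' (E (f x))"
      unfolding E_def by (rule someI)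
    with E' show ?thesis by (metis exec_deterministic)
  qed
  have "exec (c @ d) s (T + T') (bind_pmf (map_pmf f N) E)"
    using c E by (intro exec_append) auto
  moreover have "map_pmf (\<lambda>s. s 0) (bind_pmf (map_pmf f N) E) = bind_pmf N M"
    unfolding map_bind_pmf bind_map_pmf using E by (intro bind_pmf_cong) auto
  ultimately show ?thesis
    unfolding computes_def by blast
qed

lemma computes_append_det:
  assumes "exec c s T (return_pmf s')" and "computes d s' T' M"
  shows "computes (c @ d) s (T + T') M"
  using computes_append[of c s T "\<lambda>s. s" "return_pmf s'" d T' "\<lambda>_. M"] assms by (simp add: bind_return_pmf)

section \<open>Coin tosses and the preparation of the input\<close>

abbreviation coin :: "bool pmf" where
  "coin \<equiv> bernoulli_pmf (1/2)"

primrec coins :: "nat \<Rightarrow> bool list pmf" where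
  "coins 0 = return_pmf []"
| "coins (Suc n) = bind_pmf coin (\<lambda>b. map_pmf (Cons b) (coins n))"

lemma length_coins: "bs \<in> set_pmf (coins n) \<Longrightarrow> length bs = n"
  by (induction n arbitrary: bs) auto

lemma pmf_coins: "length bs = n \<Longrightarrow> pmf (coins n) bs = 1 / 2 ^ n"
proof (induction n arbitrary: bs)
  case (Suc n)
  then obtain b cs where bs: "bs = b # cs" "length cs = n" by (cases bs) auto
  have "pmf (map_pmf (Cons a) (coins n)) bs = (if a = b then 1 / 2 ^ n else 0)" for a
    using bs Suc.IH[of cs] pmf_map_inj'[of "Cons a" "coins n" cs]
    by (auto intro: pmf_map_outside)
  then show ?case
    by (cases b) (simp_all add: pmf_bind)
qed simp

text \<open>Every round uses one coin and shortens the counter by one. The number of rounds is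
  therefore fixed in advance, and the loop acts as a \<open>fold\<close> over a uniform bit
  string.\<close>

lemma exec_toss_loop:
  assumes body: "\<And>s. s c \<noteq> [] \<Longrightarrow> exec body s m (map_pmf (\<lambda>b. F b s) coin)"
    and counter: "\<And>b s. s c \<noteq> [] \<Longrightarrow> length (F b s c) = length (s c) - 1"
  shows "exec [While (Nonempty c) body] s (Suc (length (s c) * Suc m))
    (map_pmf (\<lambda>bs. fold F bs s) (coins (length (s c))))"
proof (induction "length (s c)" arbitrary: s)
  case 0
  then show ?case by (simp add: exec_While_False)
next
  case (Suc n)
  then have ne: "s c \<noteq> []" by auto
  have "exec [While (Nonempty c) body] s (Suc (m + Suc (n * Suc m)))
     (bind_pmf (map_pmf (\<lambda>b. F b s) coin) (\<lambda>s'. map_pmf (\<lambda>bs. fold F bs s') (coins n)))"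
  proof (rule exec_While_True[OF _ body])
    fix s' assume "s' \<in> set_pmf (map_pmf (\<lambda>b. F b s) coin)"
    then have "n = length (s' c)" using counter[of s, OF ne] Suc.hyps(2) by auto
    with Suc.hyps(1)[of s'] show "exec [While (Nonempty c) body] s' (Suc (n * Suc m))
      (map_pmf (\<lambda>bs. fold F bs s') (coins n))" by simp
  qed (use ne in auto)
  moreover have "Suc (m + Suc (n * Suc m)) = Suc (length (s c) * Suc m)"
    by (simp flip: Suc.hyps(2))
  ultimately show ?case
    by (simp add: bind_map_pmf map_bind_pmf pmf.map_comp o_def algebra_simps flip: Suc.hyps(2))
qed

text \<open>The reversal is wanted in both uses: it restores the input from its reversed copy, and
  it presents the output of \<open>A\<close> last bit first.\<close>

definition move :: "nat \<Rightarrow> nat \<Rightarrow> prog" where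
  "move a b = [While (Nonempty a) [Branch (Head a) [Push b True] [Push b False], Pop a]]"

lemma exec_move:
  assumes "a \<noteq> b"
  shows "exec (move a b) s (Suc (4 * length (s a))) (return_pmf (s(a := [], b := rev (s a) @ s b)))"
proof (induction "s a" arbitrary: s)
  case Nil
  then show ?case unfolding move_def by (intro exec_While_False) (auto simp: fun_eq_iff)
next
  case (Cons x xs)
  let ?s = "s(a := xs, b := x # s b)"
  have "exec (move a b) s (Suc (3 + (Suc (4 * length xs)))) (return_pmf (?s(a := [], b := rev (?s a) @ ?s b)))"
    unfolding move_def
  proof (rule exec_While_det)
    show "exec [Branch (Head a) [Push b True] [Push b False], Pop a] s 3 (return_pmf ?s)"
      using assms by (cases x; auto simp: fun_eq_iff simp flip: Cons.hyps(2))
    show "exec [While (Nonempty a) [Branch (Head a) [Push b True] [Push b False], Pop a]] ?s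
       (Suc (4 * length xs)) (return_pmf (?s(a := [], b := rev (?s a) @ ?s b)))"
      using Cons.hyps(1)[of ?s] assms by (simp add: move_def)
  qed (simp add: Cons.hyps(2)[symmetric])
  moreover have "?s(a := [], b := rev (?s a) @ ?s b) = s(a := [], b := rev (s a) @ s b)"
    using assms by (auto simp: fun_eq_iff Cons.hyps(2)[symmetric])
  moreover have "Suc (3 + (Suc (4 * length xs))) = Suc (4 * length (s a))"
    by (simp add: Cons.hyps(2)[symmetric])
  ultimately show ?case by metis
qed

lemma exec_clear:
  "exec [While (Nonempty a) [Pop a]] s (Suc (2 * length (s a))) (return_pmf (s(a := [])))"
proof (induction "s a" arbitrary: s)
  case Nil
  then show ?case by (intro exec_While_False) (auto simp: fun_eq_iff)
next
  case (Cons x xs)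
  have "exec [While (Nonempty a) [Pop a]] s (Suc (1 + (Suc (2 * length xs)))) (return_pmf ((s(a := xs))(a := [])))"
    using Cons.hyps(1)[of "s(a := xs)"]
    by (intro exec_While_det[where s' = "s(a := xs)"]) (simp_all add: Cons.hyps(2)[symmetric])
  moreover have "Suc (1 + (Suc (2 * length xs))) = Suc (2 * length (s a))"
    by (simp add: Cons.hyps(2)[symmetric])
  ultimately show ?case by (metis fun_upd_upd)
qed

section \<open>Extracting the two parameters from the coded input\<close>

lemma encode_simps [simp]:
  "encode [] = []"
  "encode (x # xs) = concat (map (\<lambda>b. [True, b]) x) @ False # encode xs"
  "encode (xs @ ys) = encode xs @ encode ys"
  by (simp_all add: encode_def)

lemma length_concat_pairs [simp]: "length (concat (map (\<lambda>b. [f b, g b]) x)) = 2 * length x"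
  by (induction x) auto

text \<open>Registers 0 mod 3 are the workspace, 1 mod 3 and 2 mod 3 belong to the two subroutines.\<close>

definition scan_bits :: prog where
  "scan_bits = [While (Head 0)
     [Pop 0, Push 3 True, Branch (Head 0) [Push 3 True] [Push 3 False], Pop 0,
      Branch (Nonempty 6) [] [Push 9 True]]]"

text \<open>Register 6 is empty only while the first string is scanned, so register 9 receives the
  length of that string alone.\<close>

lemma exec_scan_bits:
  assumes "s 0 = concat (map (\<lambda>b. [True, b]) x) @ False # z"
  shows "exec scan_bits s (Suc (8 * length x)) (return_pmf (s(0 := False # z,
     3 := rev (concat (map (\<lambda>b. [True, b]) x)) @ s 3,
     9 := if s 6 = [] then replicate (length x) True @ s 9 else s 9)))"
  using assms
proof (induction x arbitrary: s)
  case Nil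
  then show ?case unfolding scan_bits_def by (intro exec_While_False) (auto simp: fun_eq_iff)
next
  case (Cons b x)
  let ?s = "s(0 := concat (map (\<lambda>b. [True, b]) x) @ False # z, 3 := b # True # s 3,
    9 := if s 6 = [] then True # s 9 else s 9)"
  have "exec scan_bits s (Suc (7 + (Suc (8 * length x)))) (return_pmf (?s(0 := False # z,
     3 := rev (concat (map (\<lambda>b. [True, b]) x)) @ ?s 3,
     9 := if ?s 6 = [] then replicate (length x) True @ ?s 9 else ?s 9)))"
    unfolding scan_bits_def
  proof (rule exec_While_det)
    show "exec [Pop 0, Push 3 True, Branch (Head 0) [Push 3 True] [Push 3 False], Pop 0,
      Branch (Nonempty 6) [] [Push 9 True]] s 7 (return_pmf ?s)"
      using Cons.prems by (cases b; cases "s 6 = []") (auto simp: fun_eq_iff)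
    show "exec [While (Head 0)
     [Pop 0, Push 3 True, Branch (Head 0) [Push 3 True] [Push 3 False], Pop 0,
      Branch (Nonempty 6) [] [Push 9 True]]] ?s (Suc (8 * length x)) (return_pmf (?s(0 := False # z,
     3 := rev (concat (map (\<lambda>b. [True, b]) x)) @ ?s 3,
     9 := if ?s 6 = [] then replicate (length x) True @ ?s 9 else ?s 9)))"
      by (rule Cons.IH[of ?s, unfolded scan_bits_def]) simp
  qed (use Cons.prems in simp)
  moreover have "?s(0 := False # z,
     3 := rev (concat (map (\<lambda>b. [True, b]) x)) @ ?s 3,
     9 := if ?s 6 = [] then replicate (length x) True @ ?s 9 else ?s 9) =
     s(0 := False # z,
     3 := rev (concat (map (\<lambda>b. [True, b]) (b # x))) @ s 3,
     9 := if s 6 = [] then replicate (length (b # x)) True @ s 9 else s 9)"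
    by (auto simp: fun_eq_iff replicate_app_Cons_same)
  moreover have "Suc (7 + Suc (8 * length x)) = Suc (8 * length (b # x))" by simp
  ultimately show ?case by metis
qed

text \<open>Scanning leaves the reversed input in register 3, the number of strings in register 6 and the
  length of the first string in register 9 (both in unary), and starts the input of the first
  subroutine, from the bottom, in register 1.\<close>

definition scan :: prog where
  "scan = [While (Nonempty 0)
     (scan_bits @ [Pop 0, Push 3 False, Push 1 True, Push 1 True, Push 6 True])]"

text \<open>The time bound must hold on arbitrary lists, so the parameter is defined for all of
  them. On a nonempty list of instances it is their common length.\<close>

definition first_length :: "bool list list \<Rightarrow> nat" where
  "first_length xs = (case xs of [] \<Rightarrow> 0 | x # _ \<Rightarrow> length x)"

text \<open>A string of length \<open>n\<close> costs \<open>8 * n + 7\<close> steps and has a code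
  of \<open>2 * n + 1\<close> bits, whence the factor 7.\<close>

lemma exec_scan:
  assumes "s 0 = encode xs"
  shows "exec scan s (Suc (7 * length (encode xs))) (return_pmf (s(0 := [],
     3 := rev (encode xs) @ s 3,
     1 := replicate (2 * length xs) True @ s 1,
     6 := replicate (length xs) True @ s 6,
     9 := if s 6 = [] then replicate (first_length xs) True @ s 9 else s 9)))"
  using assms
proof (induction xs arbitrary: s)
  case Nil
  then show ?case unfolding scan_def by (intro exec_While_False) (auto simp: fun_eq_iff first_length_def)
next
  case (Cons x xs)
  let ?x = "concat (map (\<lambda>b. [True, b]) x)"
  let ?s1 = "s(0 := False # encode xs, 3 := rev ?x @ s 3,
     9 := if s 6 = [] then replicate (length x) True @ s 9 else s 9)"
  let ?s2 = "?s1(0 := encode xs, 3 := False # ?s1 3, 1 := True # True # ?s1 1, 6 := True # ?s1 6)"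
  have body: "exec (scan_bits @ [Pop 0, Push 3 False, Push 1 True, Push 1 True, Push 6 True]) s
     (Suc (8 * length x) + 5) (return_pmf ?s2)"
    by (rule exec_append_det[OF exec_scan_bits[of s x "encode xs"]])
      (use Cons.prems in \<open>auto simp: fun_eq_iff\<close>)
  have *: "?s2(0 := [],
     3 := rev (encode xs) @ ?s2 3,
     1 := replicate (2 * length xs) True @ ?s2 1,
     6 := replicate (length xs) True @ ?s2 6,
     9 := if ?s2 6 = [] then replicate (first_length xs) True @ ?s2 9 else ?s2 9) =
     s(0 := [],
     3 := rev (encode (x # xs)) @ s 3,
     1 := replicate (2 * length (x # xs)) True @ s 1,
     6 := replicate (length (x # xs)) True @ s 6,
     9 := if s 6 = [] then replicate (first_length (x # xs)) True @ s 9 else s 9)"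
    by (auto simp: fun_eq_iff replicate_app_Cons_same first_length_def)
  have "exec scan s (Suc ((Suc (8 * length x) + 5) + Suc (7 * length (encode xs)))) (return_pmf (?s2(0 := [],
     3 := rev (encode xs) @ ?s2 3,
     1 := replicate (2 * length xs) True @ ?s2 1,
     6 := replicate (length xs) True @ ?s2 6,
     9 := if ?s2 6 = [] then replicate (first_length xs) True @ ?s2 9 else ?s2 9)))"
    unfolding scan_def by (rule exec_While_det[OF _ body])
      (use Cons.prems in \<open>simp add: neq_Nil_conv\<close>, rule Cons.IH[unfolded scan_def], simp)
  then show ?case
    unfolding * by (rule exec_mono) simp
qed

text \<open>Two pushes per unit, since the code of the bit \<open>True\<close> is
  \<open>[True, True]\<close>.\<close>

definition copy_unary :: prog where
  "copy_unary = [While (Nonempty 9) [Push 1 True, Push 1 True, Pop 9]]"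

lemma exec_copy_unary:
  "exec copy_unary s (Suc (4 * length (s 9)))
    (return_pmf (s(9 := [], 1 := replicate (2 * length (s 9)) True @ s 1)))"
proof (induction "s 9" arbitrary: s)
  case Nil
  then show ?case unfolding copy_unary_def by (intro exec_While_False) (auto simp: fun_eq_iff)
next
  case (Cons x xs)
  let ?s = "s(9 := xs, 1 := True # True # s 1)"
  have "exec copy_unary s (Suc (3 + Suc (4 * length xs)))
    (return_pmf (?s(9 := [], 1 := replicate (2 * length (?s 9)) True @ ?s 1)))"
    unfolding copy_unary_def
  proof (rule exec_While_det)
    show "exec [Push 1 True, Push 1 True, Pop 9] s 3 (return_pmf ?s)"
      by (auto simp: fun_eq_iff simp flip: Cons.hyps(2))
    show "exec [While (Nonempty 9) [Push 1 True, Push 1 True, Pop 9]] ?s (Suc (4 * length xs))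
     (return_pmf (?s(9 := [], 1 := replicate (2 * length (?s 9)) True @ ?s 1)))"
      using Cons.hyps(1)[of ?s] by (simp add: copy_unary_def)
  qed (simp flip: Cons.hyps(2))
  moreover have "?s(9 := [], 1 := replicate (2 * length (?s 9)) True @ ?s 1) =
     s(9 := [], 1 := replicate (2 * length (s 9)) True @ s 1)"
    by (auto simp: fun_eq_iff replicate_app_Cons_same simp flip: Cons.hyps(2))
  ultimately show ?case by (simp flip: Cons.hyps(2))
qed

text \<open>The stack in register 1 grows from the bottom: terminator and bits of the second string,
  the number of instances, then terminator and bits of the first. The length found early by
  \<open>scan\<close> therefore waits in register 9.\<close>

definition preprocess :: prog where
  "preprocess = Push 1 False # scan @ Push 1 False # copy_unary"

definition preprocessed :: "bool list list \<Rightarrow> store" where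
  "preprocessed xs = (\<lambda>_. [])(3 := rev (encode xs), 6 := replicate (length xs) True,
     1 := encode [replicate (first_length xs) True, replicate (length xs) True])"

lemma concat_replicate_True [simp]:
  "concat (replicate n [True, True]) = replicate (2 * n) True"
  by (induction n) auto

lemma first_length_le: "first_length xs \<le> length (encode xs)"
  by (cases xs) (auto simp: first_length_def)

lemma length_le_encode: "length xs \<le> length (encode xs)"
  by (induction xs) auto

lemma exec_preprocess:
  "exec preprocess (input_store xs) (11 * length (encode xs) + 4) (return_pmf (preprocessed xs))"
proof -
  let ?m = "length (encode xs)" and ?n = "first_length xs"
  let ?s1 = "(input_store xs)(1 := [False])"
  let ?s2 = "?s1(0 := [], 3 := rev (encode xs), 1 := replicate (2 * length xs) True @ [False],
     6 := replicate (length xs) True, 9 := replicate ?n True)"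
  let ?s3 = "?s2(1 := False # ?s2 1)"
  have "exec ([Push 1 False] @ scan @ [Push 1 False] @ copy_unary) (input_store xs)
     (1 + (Suc (7 * ?m) + (1 + Suc (4 * length (?s3 9)))))
     (return_pmf (?s3(9 := [], 1 := replicate (2 * length (?s3 9)) True @ ?s3 1)))"
  proof (rule exec_append_det[where s' = ?s1], goal_cases)
    case 2
    show ?case
    proof (rule exec_append_det[where s' = ?s2], goal_cases)
      case 1
      show ?case using exec_scan[of ?s1 xs] by (simp add: input_store_def)
    next
      case 2
      show ?case by (rule exec_append_det[OF _ exec_copy_unary]) (auto simp: fun_eq_iff)
    qed
  qed (simp add: input_store_def)
  also have "?s3(9 := [], 1 := replicate (2 * length (?s3 9)) True @ ?s3 1) = preprocessed xs"
    by (auto simp: preprocessed_def fun_eq_iff input_store_def)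
  finally show ?thesis
    unfolding preprocess_def append.simps by (rule exec_mono) (use first_length_le[of xs] in simp)
qed

section \<open>The comparison algorithm\<close>

text \<open>The help string is tossed directly in its code; the bit tossed first lies deepest, so it is the
  last bit of the string.\<close>

definition toss_help :: prog where
  "toss_help = [Push 2 False, While (Nonempty 1) [Toss 2, Push 2 True, Pop 1]]"

definition help_step :: "bool \<Rightarrow> store \<Rightarrow> store" where
  "help_step b s = s(2 := True # b # s 2, 1 := tl (s 1))"

lemma fold_help_step:
  "fold help_step bs s 2 = concat (map (\<lambda>b. [True, b]) (rev bs)) @ s 2"
  "r \<noteq> 1 \<Longrightarrow> r \<noteq> 2 \<Longrightarrow> fold help_step bs s r = s r"
  by (induction bs arbitrary: s) (auto simp: help_step_def)

lemma exec_toss_help: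
  "exec toss_help s (4 * length (s 1) + 2)
    (map_pmf (\<lambda>bs. fold help_step bs (s(2 := False # s 2))) (coins (length (s 1))))"
proof -
  let ?s = "s(2 := False # s 2)"
  have "exec [While (Nonempty 1) [Toss 2, Push 2 True, Pop 1]] ?s (Suc (length (?s 1) * Suc (Suc 2)))
    (map_pmf (\<lambda>bs. fold help_step bs ?s) (coins (length (?s 1))))"
    by (rule exec_toss_loop, rule exec_Toss) (auto simp: help_step_def fun_eq_iff)
  then show ?thesis
    by (simp add: toss_help_def exec_Suc algebra_simps)
qed

text \<open>A subroutine may print a vector of the wrong length; \<open>pad\<close> is how the comparison loop reads it.\<close>

primrec pad :: "nat \<Rightarrow> bool list \<Rightarrow> bool list" where
  "pad 0 z = []"
| "pad (Suc n) z = (z \<noteq> [] \<and> hd z) # pad n (tl z)"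

lemma pad_length: "length z = n \<Longrightarrow> pad n z = z"
  by (induction n arbitrary: z) (auto simp: length_Suc_conv)

lemma length_pad [simp]: "length (pad n z) = n"
  by (induction n arbitrary: z) auto

text \<open>The second vector is kept even if it equals \<open>b\<close> again, which bounds the
  number of tosses. Vectors are in order of tossing, hence the reversals.\<close>

definition avoid :: "nat \<Rightarrow> bool list \<Rightarrow> bool list pmf" where
  "avoid k b = bind_pmf (coins k)
     (\<lambda>r. if r = pad k (rev b) then map_pmf rev (coins k) else return_pmf (rev r))"

text \<open>The vector \<open>r\<close> is tossed from its last bit to its first, while \<open>b\<close> is read in reverse from
  register 15. Register 12 becomes nonempty once they differ, and register 9 counts the bits in case
  a second vector has to be tossed.\<close>

definition compare_body :: prog where
  "compare_body = [Toss 0,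
     Branch (Head 15) [Branch (Head 0) [] [Push 12 True]] [Branch (Head 0) [Push 12 True] []],
     Pop 15, Pop 6, Push 9 True]"

definition compare_step :: "bool \<Rightarrow> store \<Rightarrow> store" where
  "compare_step b s = s(0 := b # s 0, 12 := if b = holds (Head 15) s then s 12 else True # s 12,
     15 := tl (s 15), 6 := tl (s 6), 9 := True # s 9)"

lemma compare_step_simps:
  "compare_step b s 0 = b # s 0" "compare_step b s 9 = True # s 9"
  "compare_step b s 15 = tl (s 15)"
  "compare_step b s 12 \<noteq> [] \<longleftrightarrow> s 12 \<noteq> [] \<or> b \<noteq> (s 15 \<noteq> [] \<and> hd (s 15))"
  by (auto simp: compare_step_def neq_Nil_conv)

lemma fold_compare_step:
  "fold compare_step bs s 0 = rev bs @ s 0"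
  "fold compare_step bs s 9 = replicate (length bs) True @ s 9"
  by (induction bs arbitrary: s) (simp_all add: compare_step_simps replicate_app_Cons_same)

text \<open>The flag is never cleared, so it records a disagreement at any position. An exhausted
  register 15 reads as \<open>False\<close>, just as in \<open>pad\<close>.\<close>

lemma fold_compare_step_flag:
  "fold compare_step bs s 12 \<noteq> [] \<longleftrightarrow> s 12 \<noteq> [] \<or> bs \<noteq> pad (length bs) (s 15)"
proof (induction bs arbitrary: s)
  case (Cons b bs)
  then show ?case
    by (simp only: fold_Cons o_apply Cons.IH compare_step_simps length_Cons pad.simps list.inject) blast
qed simp

lemma exec_compare_loop:
  "exec [While (Nonempty 6) compare_body] s (8 * length (s 6) + 1)
    (map_pmf (\<lambda>bs. fold compare_step bs s) (coins (length (s 6))))"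
proof -
  have "exec compare_body s 7 (map_pmf (\<lambda>b. compare_step b s) coin)" for s
  proof -
    have "exec compare_body s (Suc 6) (map_pmf (\<lambda>b. compare_step b s) coin)"
      unfolding compare_body_def
    proof (rule exec_Toss)
      fix b
      show "exec [Branch (Head 15) [Branch (Head 0) [] [Push 12 True]] [Branch (Head 0) [Push 12 True] []],
          Pop 15, Pop 6, Push 9 True] (s(0 := b # s 0)) 6 (return_pmf (compare_step b s))"
        by (cases "holds (Head 15) s"; cases b) (auto simp: compare_step_def fun_eq_iff)
    qed
    then show ?thesis by simp
  qed
  then have "exec [While (Nonempty 6) compare_body] s (Suc (length (s 6) * Suc 7))
    (map_pmf (\<lambda>bs. fold compare_step bs s) (coins (length (s 6))))"
    by (rule exec_toss_loop) (auto simp: compare_step_def)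
  then show ?thesis by (simp add: algebra_simps)
qed

definition fallback :: prog where
  "fallback = [Branch (Nonempty 12) []
     [While (Nonempty 0) [Pop 0], While (Nonempty 9) [Toss 0, Pop 9]]]"

lemma computes_fallback:
  "computes fallback s (2 * length (s 0) + 3 * length (s 9) + 3)
     (if s 12 \<noteq> [] then return_pmf (s 0) else map_pmf rev (coins (length (s 9))))"
proof (cases "s 12 = []")
  case False
  then have "exec fallback s (Suc 0) (return_pmf s)"
    by (simp add: fallback_def)
  then have "computes fallback s (Suc 0) (return_pmf (s 0))"
    unfolding computes_def by fastforce
  with False show ?thesis by (auto intro: computes_mono)
next
  case True
  let ?F = "\<lambda>b s. s(0 := b # s 0, 9 := tl (s 9))"
  let ?s = "s(0 := [])"
  have loop: "exec [While (Nonempty 9) [Toss 0, Pop 9]] ?s (Suc (length (?s 9) * Suc (Suc 1)))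
    (map_pmf (\<lambda>bs. fold ?F bs ?s) (coins (length (?s 9))))"
    by (rule exec_toss_loop, rule exec_Toss) (auto simp: fun_eq_iff)
  have fold: "fold ?F bs t 0 = rev bs @ t 0" for bs and t :: store
    by (induction bs arbitrary: t) auto
  have "exec ([While (Nonempty 0) [Pop 0]] @ [While (Nonempty 9) [Toss 0, Pop 9]]) s
     (Suc (2 * length (s 0)) + Suc (length (?s 9) * Suc (Suc 1)))
     (map_pmf (\<lambda>bs. fold ?F bs ?s) (coins (length (s 9))))"
    using loop by (intro exec_append_det[OF exec_clear]) simp
  then have "exec fallback s (Suc (Suc (2 * length (s 0)) + Suc (length (?s 9) * Suc (Suc 1))))
     (map_pmf (\<lambda>bs. fold ?F bs ?s) (coins (length (s 9))))"
    using True unfolding fallback_def by (simp only: exec_Suc holds.simps) simp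
  then have "computes fallback s (Suc (Suc (2 * length (s 0)) + Suc (length (?s 9) * Suc (Suc 1))))
     (map_pmf rev (coins (length (s 9))))"
    unfolding computes_def by - (rule exI, erule conjI, simp add: pmf.map_comp o_def fold)
  then have "computes fallback s (2 * length (s 0) + 3 * length (s 9) + 3)
     (map_pmf rev (coins (length (s 9))))"
    by (rule computes_mono) simp
  with True show ?thesis by simp
qed

definition finish :: prog where
  "finish = move 2 15 @ [While (Nonempty 6) compare_body] @ fallback"

lemma computes_finish:
  assumes "s 0 = []" "s 9 = []" "s 12 = []" "s 15 = []" "length (s 6) = k"
  shows "computes finish s (4 * length (s 2) + 13 * k + 5) (avoid k (s 2))"
proof -
  let ?s = "s(2 := [], 15 := rev (s 2))"
  \<comment> \<open>The loop takes \<open>8 * k + 1\<close> steps; the fallback takes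
    \<open>5 * k + 3\<close>, as registers 0 and 9 then both hold \<open>k\<close> bits.\<close>
  have tail: "computes ([While (Nonempty 6) compare_body] @ fallback) ?s ((8 * k + 1) + (5 * k + 3))
    (avoid k (s 2))"
    unfolding avoid_def
  proof (rule computes_append)
    show "exec [While (Nonempty 6) compare_body] ?s (8 * k + 1)
      (map_pmf (\<lambda>bs. fold compare_step bs ?s) (coins k))"
      using exec_compare_loop[of ?s] assms(5) by simp
  next
    fix bs assume "bs \<in> set_pmf (coins k)"
    then have k: "length bs = k" by (rule length_coins)
    let ?t = "fold compare_step bs ?s"
    have "length (?t 0) = k" "length (?t 9) = k" "?t 0 = rev bs"
      "?t 12 \<noteq> [] \<longleftrightarrow> bs \<noteq> pad k (rev (s 2))"
      using assms k by (simp_all add: fold_compare_step fold_compare_step_flag)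
    then show "computes fallback ?t (5 * k + 3)
      (if bs = pad k (rev (s 2)) then map_pmf rev (coins k) else return_pmf (rev bs))"
      using computes_fallback[of ?t] by auto
  qed
  then have "computes finish s (Suc (4 * length (s 2)) + ((8 * k + 1) + (5 * k + 3))) (avoid k (s 2))"
    unfolding finish_def using assms(4) by (intro computes_append_det[OF exec_move]) auto
  then show ?thesis by (rule computes_mono) simp
qed

section \<open>Assembling the algorithm from its subroutines\<close>

definition reg1 :: "nat \<Rightarrow> nat" where "reg1 r = 3 * r + 1"
definition reg2 :: "nat \<Rightarrow> nat" where "reg2 r = 3 * r + 2"

lemma inj_reg [simp]: "inj reg1" "inj reg2"
  by (auto simp: inj_def reg1_def reg2_def)

lemma range_reg: "r \<in> range reg1 \<longleftrightarrow> r mod 3 = 1" "r \<in> range reg2 \<longleftrightarrow> r mod 3 = 2"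
  unfolding image_iff reg1_def reg2_def bex_UNIV by presburger+

lemma overlay_reg:
  "overlay reg1 u s 1 = u 0" "overlay reg2 u s 2 = u 0"
  "r mod 3 \<noteq> 1 \<Longrightarrow> overlay reg1 u s r = s r" "r mod 3 \<noteq> 2 \<Longrightarrow> overlay reg2 u s r = s r"
  using overlay_in[of reg1 u s 0] overlay_in[of reg2 u s 0] overlay_notin[of r reg1 u s] overlay_notin[of r reg2 u s]
  by (simp_all add: range_reg numeral_2_eq_2 del: overlay_in overlay_notin) (simp_all add: reg1_def reg2_def)

lemma computes_run_finish:
  assumes A: "exec A (input_store ys) T D"
    and s: "s \<circ> reg2 = input_store ys" "s 0 = []" "s 9 = []" "s 12 = []" "s 15 = []" "length (s 6) = k"
  shows "computes (map (rename reg2) A @ finish) s (5 * T + 4 * length (encode ys) + 13 * k + 5)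
    (bind_pmf (result A ys) (avoid k))"
proof -
  have "computes (map (rename reg2) A @ finish) s (T + (4 * (length (encode ys) + T) + 13 * k + 5))
    (bind_pmf D (\<lambda>u. avoid k (u 0)))"
  proof (rule computes_append)
    show "exec (map (rename reg2) A) s T (map_pmf (\<lambda>u. overlay reg2 u s) D)"
      using A s by (intro exec_rename) auto
  next
    fix u assume u: "u \<in> set_pmf D"
    let ?s = "overlay reg2 u s"
    \<comment> \<open>\<open>A\<close> may print far more than \<open>k\<close> bits, and
      \<open>finish\<close> has to traverse them all.\<close>
    have "length (u 0) \<le> length (encode ys) + T"
      using length_exec[OF A u, of 0] by (simp add: input_store_def)
    moreover have "computes finish ?s (4 * length (?s 2) + 13 * k + 5) (avoid k (?s 2))"
      using s by (intro computes_finish) (simp_all add: overlay_reg)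
    ultimately show "computes finish ?s (4 * (length (encode ys) + T) + 13 * k + 5) (avoid k (u 0))"
      by (auto elim!: computes_mono simp: overlay_reg)
  qed
  then have "computes (map (rename reg2) A @ finish) s (T + (4 * (length (encode ys) + T) + 13 * k + 5))
    (bind_pmf (result A ys) (avoid k))"
    by (simp add: result_eq[OF A] bind_map_pmf)
  then show ?thesis by (rule computes_mono) simp
qed

text \<open>The coefficients are natural numbers. Time bounds may thus be evaluated at an upper
  bound for the length of the code.\<close>

lemma poly_nat_mono: "x \<le> y \<Longrightarrow> poly (t :: nat poly) x \<le> poly t y"
  by (induction t) (auto intro!: add_mono mult_mono)

text \<open>\<open>B\<close> yields the length of the help string in unary. The help string is coded
  into register 2 first, and \<open>move 3 2\<close> puts the instances on top of it, which gives
  the code of \<open>xs @ [s]\<close>.\<close>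

definition compare_prog :: "prog \<Rightarrow> prog \<Rightarrow> prog" where
  "compare_prog B A = preprocess @ map (rename reg1) B @ toss_help @ move 3 2 @ map (rename reg2) A @ finish"

text \<open>The length of the help string is read off the output of \<open>B\<close>, so the formula
  makes sense on every input and not only on instances.\<close>

definition compare_dist :: "prog \<Rightarrow> prog \<Rightarrow> bool list list \<Rightarrow> bool list pmf" where
  "compare_dist B A xs =
     bind_pmf (result B [replicate (first_length xs) True, replicate (length xs) True]) (\<lambda>y.
     bind_pmf (coins (length y)) (\<lambda>bs.
     bind_pmf (result A (xs @ [rev bs])) (avoid (length xs))))"

text \<open>The input of \<open>B\<close> consists of two unary strings of length at most
  \<open>m\<close>, with a code of at most \<open>4 * m + 2\<close> bits. Adding the running time of
  \<open>B\<close>, \<open>U m\<close> bounds the length of the help string, and \<open>V m\<close>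
  the code of the input of \<open>A\<close>.\<close>

lemma computes_compare_prog:
  assumes B: "\<And>xs. halts_within B xs (poly tB (length (encode xs)))"
    and A: "\<And>xs. halts_within A xs (poly tA (length (encode xs)))"
  defines "U \<equiv> \<lambda>m. 4 * m + 2 + poly tB (4 * m + 2)"
  defines "V \<equiv> \<lambda>m. m + 2 * U m + 1"
  assumes m: "m = length (encode xs)"
  shows "computes (compare_prog B A) (input_store xs)
    ((11 * m + 4) + (poly tB (4 * m + 2) + (4 * U m + 2 + (4 * m + 1 + (5 * poly tA (V m) + 4 * V m + 13 * m + 5)))))
    (compare_dist B A xs)"
proof -
  let ?in = "[replicate (first_length xs) True, replicate (length xs) True]"
  let ?s1 = "preprocessed xs"
  have in_le: "length (encode ?in) \<le> 4 * m + 2"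
    using first_length_le[of xs] length_le_encode[of xs] m by simp
  obtain D where D: "exec B (input_store ?in) (poly tB (length (encode ?in))) D"
    using B exec_if_halts_within by blast
  have tB_le: "poly tB (length (encode ?in)) \<le> poly tB (4 * m + 2)"
    by (rule poly_nat_mono[OF in_le])
  have s1: "?s1 \<circ> reg1 = input_store ?in"
  proof -
    \<comment> \<open>Registers 3 and 6 are 0 mod 3, so \<open>B\<close> finds only its own register
      0 filled.\<close>
    have "reg1 r \<noteq> 3" "reg1 r \<noteq> 6" "reg1 r = 1 \<longleftrightarrow> r = 0" for r
      unfolding reg1_def by presburger+
    then show ?thesis by (auto simp: fun_eq_iff preprocessed_def input_store_def)
  qed
  \<comment> \<open>The stages are treated from the last to the first, because
    \<open>computes\<close> speaks of the whole remaining program.\<close>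
  have run: "computes (move 3 2 @ map (rename reg2) A @ finish) s
      (4 * m + 1 + (5 * poly tA (V m) + 4 * V m + 13 * m + 5))
      (bind_pmf (result A (xs @ [ys])) (avoid (length xs)))"
    if s: "s 3 = rev (encode xs)" "s 2 = encode [ys]" "length ys \<le> U m"
      "s 0 = []" "s 9 = []" "s 12 = []" "s 15 = []" "length (s 6) = length xs"
      "\<And>r. r > 0 \<Longrightarrow> s (reg2 r) = []" for s ys
  proof -
    let ?s = "s(3 := [], 2 := rev (s 3) @ s 2)"
    have le: "length (encode (xs @ [ys])) \<le> V m"
      using s(3) m by (simp add: V_def)
    obtain E where E: "exec A (input_store (xs @ [ys])) (poly tA (length (encode (xs @ [ys])))) E"
      using A exec_if_halts_within by blast
    then have E': "exec A (input_store (xs @ [ys])) (poly tA (V m)) E"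
      using poly_nat_mono[OF le] by (rule exec_mono)
    have reg2: "reg2 r \<noteq> 3" "reg2 r = 2 \<longleftrightarrow> r = 0" for r
      unfolding reg2_def by presburger+
    have "?s \<circ> reg2 = input_store (xs @ [ys])"
      using s by (auto simp: fun_eq_iff reg2 input_store_def)
    then have "computes (map (rename reg2) A @ finish) ?s
        (5 * poly tA (V m) + 4 * length (encode (xs @ [ys])) + 13 * length xs + 5)
        (bind_pmf (result A (xs @ [ys])) (avoid (length xs)))"
      using s by (intro computes_run_finish[OF E']) auto
    then have "computes (map (rename reg2) A @ finish) ?s (5 * poly tA (V m) + 4 * V m + 13 * m + 5)
        (bind_pmf (result A (xs @ [ys])) (avoid (length xs)))"
      by (rule computes_mono) (use le length_le_encode[of xs] m in simp)
    then have "computes (move 3 2 @ map (rename reg2) A @ finish) s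
      (Suc (4 * length (s 3)) + (5 * poly tA (V m) + 4 * V m + 13 * m + 5))
      (bind_pmf (result A (xs @ [ys])) (avoid (length xs)))"
      by (intro computes_append_det[OF exec_move]) auto
    then show ?thesis using s(1) m by simp
  qed
  have toss_help: "computes (toss_help @ move 3 2 @ map (rename reg2) A @ finish) s
     (4 * U m + 2 + (4 * m + 1 + (5 * poly tA (V m) + 4 * V m + 13 * m + 5)))
     (bind_pmf (coins (length (u 0))) (\<lambda>bs. bind_pmf (result A (xs @ [rev bs])) (avoid (length xs))))"
    if u: "u \<in> set_pmf D" and s: "s = overlay reg1 u ?s1" for u s
  proof -
    have s1: "s 1 = u 0" by (simp only: s overlay_reg)
    have sr: "s r = ?s1 r" if "r mod 3 \<noteq> 1" for r using that by (simp add: s overlay_reg)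
    have le: "length (u 0) \<le> U m"
      using length_exec[OF D u, of 0] in_le tB_le by (simp add: input_store_def U_def)
    \<comment> \<open>Neither the preprocessing nor \<open>B\<close> touches the registers 2 mod 3,
      so \<open>A\<close> will start on clean ones.\<close>
    have s2: "s (reg2 r) = []" for r
    proof -
      have "reg2 r mod 3 \<noteq> 1" "reg2 r \<noteq> 3" "reg2 r \<noteq> 6" "reg2 r \<noteq> 1"
        unfolding reg2_def by presburger+
      then show ?thesis by (simp add: sr) (simp add: preprocessed_def)
    qed
    let ?s = "s(2 := False # s 2)"
    have "computes (toss_help @ move 3 2 @ map (rename reg2) A @ finish) s
     (4 * length (s 1) + 2 + (4 * m + 1 + (5 * poly tA (V m) + 4 * V m + 13 * m + 5)))
     (bind_pmf (coins (length (s 1))) (\<lambda>bs. bind_pmf (result A (xs @ [rev bs])) (avoid (length xs))))"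
    proof (rule computes_append[OF exec_toss_help])
      fix bs assume "bs \<in> set_pmf (coins (length (s 1)))"
      then have "length bs \<le> U m" using le s1 length_coins by metis
      moreover have "fold help_step bs ?s (reg2 r) = []" if "r > 0" for r
      proof -
        have "reg2 r \<noteq> 1" "reg2 r \<noteq> 2" using that unfolding reg2_def by presburger+
        then show ?thesis by (simp add: fold_help_step s2)
      qed
      moreover have "s 2 = []" using s2[of 0] by (simp only: reg2_def mult_0_right add_0_left)
      ultimately show "computes (move 3 2 @ map (rename reg2) A @ finish) (fold help_step bs ?s)
        (4 * m + 1 + (5 * poly tA (V m) + 4 * V m + 13 * m + 5))
        (bind_pmf (result A (xs @ [rev bs])) (avoid (length xs)))"
        by (intro run) (simp_all add: fold_help_step sr, simp_all add: preprocessed_def)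
    qed
    then show ?thesis unfolding s1 by (rule computes_mono) (use le in simp)
  qed
  have "computes (map (rename reg1) B @ toss_help @ move 3 2 @ map (rename reg2) A @ finish) ?s1
    (poly tB (4 * m + 2) + (4 * U m + 2 + (4 * m + 1 + (5 * poly tA (V m) + 4 * V m + 13 * m + 5))))
    (bind_pmf D (\<lambda>u. bind_pmf (coins (length (u 0)))
      (\<lambda>bs. bind_pmf (result A (xs @ [rev bs])) (avoid (length xs)))))"
  proof (rule computes_append)
    show "exec (map (rename reg1) B) ?s1 (poly tB (4 * m + 2)) (map_pmf (\<lambda>u. overlay reg1 u ?s1) D)"
      using exec_mono[OF D tB_le] s1 by (intro exec_rename) auto
  qed (rule toss_help, simp_all)
  also have "bind_pmf D (\<lambda>u. bind_pmf (coins (length (u 0)))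
      (\<lambda>bs. bind_pmf (result A (xs @ [rev bs])) (avoid (length xs)))) = compare_dist B A xs"
    by (simp add: compare_dist_def result_eq[OF D] bind_map_pmf)
  finally show ?thesis
    unfolding compare_prog_def m by (rule computes_append_det[OF exec_preprocess])
qed

section \<open>Probability bounds\<close>

definition poly_fun :: "(nat \<Rightarrow> nat) \<Rightarrow> bool" where
  "poly_fun f \<longleftrightarrow> (\<exists>t. \<forall>m. f m = poly t m)"

lemma poly_fun_intros:
  "poly_fun (\<lambda>m. m)" "poly_fun (\<lambda>m. c)"
  "poly_fun f \<Longrightarrow> poly_fun g \<Longrightarrow> poly_fun (\<lambda>m. f m + g m)"
  "poly_fun f \<Longrightarrow> poly_fun g \<Longrightarrow> poly_fun (\<lambda>m. f m * g m)"
  "poly_fun f \<Longrightarrow> poly_fun (\<lambda>m. poly t (f m))"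
proof -
  have "\<forall>m :: nat. m = poly [:0, 1:] m" "\<forall>m. c = poly [:c:] m" for c :: nat by auto
  then show "poly_fun (\<lambda>m. m)" "poly_fun (\<lambda>m. c)" unfolding poly_fun_def by blast+
  show "poly_fun (\<lambda>m. f m + g m)" if "poly_fun f" "poly_fun g"
    using that unfolding poly_fun_def by (metis poly_add)
  show "poly_fun (\<lambda>m. f m * g m)" if "poly_fun f" "poly_fun g"
    using that unfolding poly_fun_def by (metis poly_mult)
  show "poly_fun (\<lambda>m. poly t (f m))" if "poly_fun f"
    using that unfolding poly_fun_def by (metis poly_pcompose)
qed

lemma compare_prog_correct:
  assumes "polytime B" "polytime A"
  shows "polytime (compare_prog B A)" and "result (compare_prog B A) xs = compare_dist B A xs"
proof -
  obtain tB tA where halts: "\<And>xs. halts_within B xs (poly tB (length (encode xs)))"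
      "\<And>xs. halts_within A xs (poly tA (length (encode xs)))"
    using assms unfolding polytime_def by blast
  \<comment> \<open>The time bound with \<open>U\<close> and \<open>V\<close> written out, so that
    the closure rules for \<open>poly_fun\<close> apply to it syntactically.\<close>
  define T where "T m = (11 * m + 4) + (poly tB (4 * m + 2) +
        (4 * (4 * m + 2 + poly tB (4 * m + 2)) + 2 + (4 * m + 1 +
        (5 * poly tA (m + 2 * (4 * m + 2 + poly tB (4 * m + 2)) + 1) +
         4 * (m + 2 * (4 * m + 2 + poly tB (4 * m + 2)) + 1) + 13 * m + 5))))" for m
  have comp: "computes (compare_prog B A) (input_store xs) (T (length (encode xs))) (compare_dist B A xs)" for xs
    unfolding T_def using computes_compare_prog[OF halts refl] .
  have T: "poly_fun T"
    unfolding T_def by (intro poly_fun_intros)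
  from T obtain t where t: "\<And>m. T m = poly t m" unfolding poly_fun_def by blast
  have "halts_within (compare_prog B A) xs (poly t (length (encode xs)))" for xs
    using comp[of xs] unfolding computes_def t by (blast intro: halts_within_if_exec)
  then show "polytime (compare_prog B A)" unfolding polytime_def by blast
  show "result (compare_prog B A) xs = compare_dist B A xs"
    using comp[of xs] unfolding computes_def by (metis result_eq)
qed

section \<open>The probability of hitting the true vector\<close>

lemma integrable_pmf_fun:
  assumes "\<And>x. \<bar>f x\<bar> \<le> (c :: real)"
  shows "integrable (measure_pmf M) f"
  by (rule measure_pmf.integrable_const_bound[where B = c]) (use assms in auto)

lemma integrable_pmf_indicator [simp]: "integrable (measure_pmf M) (indicator A :: _ \<Rightarrow> real)"
  by (rule integrable_pmf_fun[of _ 1]) (simp add: indicator_def)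

lemma integrable_pmf_apply [simp]: "integrable (measure_pmf M) (\<lambda>x. pmf (N x) v)"
  by (rule integrable_pmf_fun[of _ 1]) (simp add: pmf_le_1)

lemma pmf_map_rev_coins: "length v = k \<Longrightarrow> pmf (map_pmf rev (coins k)) v = 1 / 2 ^ k"
  using pmf_map_inj'[of rev "coins k" "rev v"] by (simp add: pmf_coins)

lemma length_avoid: "b \<in> set_pmf (avoid k c) \<Longrightarrow> length b = k"
  by (auto simp: avoid_def length_coins split: if_splits)

text \<open>Either the retry occurs and then produces \<open>v\<close>, with probability
  \<open>1 / 4 ^ k\<close>, or the first vector is \<open>v\<close> and is kept, which is impossible
  if \<open>b = v\<close>. Only an inequality holds, since a \<open>b\<close> of wrong length can be
  read as \<open>v\<close>.\<close>

lemma pmf_avoid_le: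
  assumes v: "length v = k"
  shows "pmf (avoid k b) v \<le> 1 / 4 ^ k + (1 - indicator {v} b) / 2 ^ k"
proof -
  let ?w = "pad k (rev b)"
  have "pmf (avoid k b) v = measure_pmf.expectation (coins k)
      (\<lambda>r. pmf (if r = ?w then map_pmf rev (coins k) else return_pmf (rev r)) v)"
    by (simp add: avoid_def pmf_bind)
  also have "\<dots> \<le> measure_pmf.expectation (coins k)
      (\<lambda>r. indicator {?w} r * (1 / 2 ^ k) + indicator {rev v} r * (1 - indicator {v} b))"
  proof (rule integral_mono)
    fix r
    show "pmf (if r = ?w then map_pmf rev (coins k) else return_pmf (rev r)) v
      \<le> indicator {?w} r * (1 / 2 ^ k) + indicator {rev v} r * (1 - indicator {v} b)"
      using pmf_map_rev_coins[OF v] pad_length[of "rev v" k] v by (auto simp: indicator_def)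
  qed (auto intro!: integrable_pmf_fun[of _ 1] simp: pmf_le_1)
  also have "\<dots> = pmf (coins k) ?w * (1 / 2 ^ k) + pmf (coins k) (rev v) * (1 - indicator {v} b)"
    by (simp add: measure_pmf_single)
  also have "\<dots> = 1 / 4 ^ k + (1 - indicator {v} b) / 2 ^ k"
    using v by (simp add: pmf_coins power_mult_distrib[symmetric] field_simps flip: power_mult_distrib)
  finally show ?thesis .
qed

text \<open>The bound for fixed \<open>b\<close> is affine in the indicator of \<open>b = v\<close>,
  so averaging over \<open>M\<close> replaces the indicator by \<open>pmf M v\<close>.\<close>

lemma pmf_bind_avoid_le:
  assumes "length v = k"
  shows "pmf (bind_pmf M (avoid k)) v \<le> 1 / 4 ^ k + (1 - pmf M v) / 2 ^ k"
proof -
  have "pmf (bind_pmf M (avoid k)) v \<le> measure_pmf.expectation M (\<lambda>b. 1 / 4 ^ k + (1 - indicator {v} b) / 2 ^ k)"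
    unfolding pmf_bind
    by (rule integral_mono) (use pmf_avoid_le[OF assms] in simp_all)
  also have "\<dots> = 1 / 4 ^ k + (1 - pmf M v) / 2 ^ k"
    by (simp add: measure_pmf_single)
  finally show ?thesis .
qed

text \<open>All terms of the average but the one for \<open>x\<close> are dropped. With
  \<open>x\<close> the good help string, this is the price of guessing it.\<close>

lemma pmf_bind_ge: "pmf M x * pmf (N x) v \<le> pmf (bind_pmf M N) v"
proof -
  have "pmf M x * pmf (N x) v = measure_pmf.expectation M (\<lambda>y. indicator {x} y * pmf (N x) v)"
    by (simp add: measure_pmf_single)
  also have "\<dots> \<le> pmf (bind_pmf M N) v"
    unfolding pmf_bind
    by (rule integral_mono) (auto intro!: integrable_pmf_fun[of _ 1] simp: indicator_def pmf_le_1)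
  finally show ?thesis .
qed

text \<open>The logarithmic bound makes \<open>4 ^ k n\<close>, which exceeds
  \<open>2 ^ (k n + l n)\<close> when \<open>l n < k n\<close>, polynomial in
  \<open>n\<close>.\<close>

lemma four_power_poly_bound:
  assumes "(\<lambda>n. real (k n)) \<in> O(\<lambda>n. log 2 (real n))"
  obtains C :: real and e :: nat where "C > 0" "\<And>n. 4 ^ k n \<le> C + real n ^ e"
proof -
  obtain c where c: "c > 0" "eventually (\<lambda>n. norm (real (k n)) \<le> c * norm (log 2 (real n))) at_top"
    using assms by (elim landau_o.bigE)
  then obtain N where N: "\<And>n. n \<ge> N \<Longrightarrow> real (k n) \<le> c * \<bar>log 2 (real n)\<bar>"
    unfolding eventually_at_top_linorder by auto
  \<comment> \<open>From \<open>4 ^ k n = 2 powr (2 * k n)\<close>, which is at most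
    \<open>n powr (2 * c)\<close> for large \<open>n\<close>.\<close>
  define e where "e = nat \<lceil>2 * c\<rceil>"
  \<comment> \<open>Absorbs the finitely many small \<open>n\<close>, about which the asymptotic
    bound says nothing.\<close>
  define C where "C = (\<Sum>n\<le>N. 4 ^ k n :: real)"
  show thesis
  proof
    show "C > 0" unfolding C_def by (intro sum_pos) auto
    fix n
    show "4 ^ k n \<le> C + real n ^ e"
    proof (cases "n \<le> N")
      case True
      then have "(4::real) ^ k n \<le> C" unfolding C_def by (intro member_le_sum) auto
      then show ?thesis by (simp add: add_increasing2)
    next
      case False
      then have n: "n \<ge> 1" "n \<ge> N" by auto
      have "(4::real) ^ k n = 2 ^ (2 * k n)"
        by (simp add: power_mult)
      also have "\<dots> = 2 powr (2 * real (k n))"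
        by (subst powr_realpow[symmetric]) simp_all
      also have "\<dots> \<le> 2 powr (log 2 (real n) * real e)"
      proof (rule powr_mono)
        have "2 * real (k n) \<le> 2 * c * log 2 (real n)"
          using N[OF n(2)] n(1) zero_le_log_cancel_iff[of 2 "real n"] by simp
        also have "\<dots> \<le> real e * log 2 (real n)"
          unfolding e_def using n(1) by (intro mult_right_mono) (linarith, simp)
        finally show "2 * real (k n) \<le> log 2 (real n) * real e" by (simp add: mult.commute)
      qed simp
      also have "\<dots> = real n ^ e"
        using n(1) by (subst powr_powr[symmetric]) (simp add: powr_realpow)
      finally show ?thesis using \<open>C > 0\<close> by simp
    qed
  qed
qed

section \<open>From help strings to an advantage over uniform guessing\<close>

theorem theorem3p1:
  fixes L :: "bool list set"
    and k l :: "nat \<Rightarrow> nat"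
    and p :: "nat \<Rightarrow> real"
    and q :: "real poly"
    and A :: prog
  assumes k_bound: "(\<lambda>n. real (k n)) \<in> O(\<lambda>n. log 2 (real n))"
    and l_less: "\<And>n. l n < k n"
    and l_computable: "polytime_computable_given k l"
    and q_pos: "\<And>n. 0 < poly q (real n)"
    and p_bound: "\<And>n. p n \<ge> 2 powr (real (l n) - real (k n)) + 1 / poly q (real n)"
    and A_polytime: "polytime A"
    and A_help: "\<And>n xs. instances (k n) n xs \<Longrightarrow>
      \<exists>s. length s = l n \<and> measure_pmf.prob (result A (xs @ [s])) {char_vec L xs} \<ge> p n"
  shows "randomized_membership_comparable k L"
proof -
  obtain B where B: "polytime B"
    "\<And>n. result B [replicate n True, replicate (k n) True] = return_pmf (replicate (l n) True)"
    using l_computable unfolding polytime_computable_given_def by blast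
  obtain C e where C: "C > 0" "\<And>n. 4 ^ k n \<le> C + real n ^ e"
    using four_power_poly_bound[OF k_bound] by blast
  \<comment> \<open>Chosen to dominate \<open>2 ^ (k n + l n) * poly q n\<close>, the reciprocal of
    the advantage.\<close>
  define r where "r = (monom 1 e + [:C:]) * q"
  have r: "poly r (real n) = (C + real n ^ e) * poly q (real n)" for n
    by (simp add: r_def poly_monom)
  have r_pos: "0 < poly r (real n)" for n
    unfolding r using C(1) q_pos by (intro mult_pos_pos add_pos_nonneg) auto
  let ?P = "compare_prog B A"
  have "(\<forall>b \<in> set_pmf (result ?P xs). length b = k n) \<and>
      measure_pmf.prob (result ?P xs) {b. b \<noteq> char_vec L xs} \<ge> (1 - 1 / 2 ^ k n) + 1 / poly r (real n)"
    if inst: "instances (k n) n xs" for n xs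
  proof -
    let ?k = "k n" and ?l = "l n" and ?v = "char_vec L xs"
    \<comment> \<open>By \<open>l n < k n\<close> there is at least one instance, so the first one
      exists and has length \<open>n\<close>.\<close>
    have len: "length xs = ?k" "first_length xs = n"
      using inst l_less[of n] by (auto simp: instances_def first_length_def split: list.splits)
    have v: "length ?v = ?k" by (simp add: char_vec_def len)
    \<comment> \<open>The output distribution of \<open>A\<close> on a uniformly random help
      string.\<close>
    define M where "M = bind_pmf (coins ?l) (\<lambda>bs. result A (xs @ [rev bs]))"
    have res: "result ?P xs = bind_pmf M (avoid ?k)"
      by (simp add: compare_prog_correct[OF B(1) A_polytime] compare_dist_def len B(2) bind_return_pmf
          M_def bind_assoc_pmf)
    obtain s where s: "length s = ?l" "pmf (result A (xs @ [s])) ?v \<ge> p n"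
      using A_help[OF inst] by (auto simp: measure_pmf_single)
    have "2 powr (real ?l - real ?k) = 2 ^ ?l / 2 ^ ?k"
      by (simp add: powr_diff powr_realpow)
    then have "2 ^ ?l / 2 ^ ?k + 1 / poly q (real n) \<le> pmf (result A (xs @ [s])) ?v"
      using p_bound[of n] s(2) by simp
    then have "(1 / 2 ^ ?l) * (2 ^ ?l / 2 ^ ?k + 1 / poly q (real n))
        \<le> (1 / 2 ^ ?l) * pmf (result A (xs @ [s])) ?v"
      by (intro mult_left_mono) auto
    also have "\<dots> \<le> pmf M ?v"
      using pmf_bind_ge[of "coins ?l" "rev s" "\<lambda>bs. result A (xs @ [rev bs])" ?v] s(1)
      by (simp add: M_def pmf_coins)
    finally have M: "1 / 2 ^ ?k + 1 / (2 ^ ?l * poly q (real n)) \<le> pmf M ?v"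
      by (simp add: distrib_left)
    have "pmf (result ?P xs) ?v \<le> 1 / 4 ^ ?k + (1 - pmf M ?v) / 2 ^ ?k"
      unfolding res by (rule pmf_bind_avoid_le[OF v])
    also have "\<dots> \<le> 1 / 4 ^ ?k + (1 - (1 / 2 ^ ?k + 1 / (2 ^ ?l * poly q (real n)))) / 2 ^ ?k"
      using M by (intro add_left_mono divide_right_mono) auto
    \<comment> \<open>The term \<open>1 / 4 ^ k\<close> contributed by the retry cancels against the
      part \<open>1 / 2 ^ k\<close> of the lower bound on \<open>pmf M v\<close>.\<close>
    also have "\<dots> = 1 / 2 ^ ?k - 1 / (2 ^ ?k * 2 ^ ?l * poly q (real n))"
    proof -
      have "(4::real) ^ ?k = 2 ^ ?k * 2 ^ ?k" by (simp flip: power_mult_distrib)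
      then show ?thesis by (simp add: diff_divide_distrib add_divide_distrib mult.assoc)
    qed
    also have "\<dots> \<le> 1 / 2 ^ ?k - 1 / poly r (real n)"
    proof -
      have "(2::real) ^ ?k * 2 ^ ?l \<le> 2 ^ ?k * 2 ^ ?k"
        using l_less[of n] by (intro mult_left_mono power_increasing) auto
      also have "\<dots> \<le> C + real n ^ e" using C(2)[of n] by (simp flip: power_mult_distrib)
      finally have "2 ^ ?k * 2 ^ ?l * poly q (real n) \<le> poly r (real n)"
        unfolding r using q_pos[of n] by (intro mult_right_mono) auto
      then show ?thesis
        using q_pos[of n] r_pos[of n] by (intro diff_left_mono divide_left_mono) auto
    qed
    finally have "pmf (result ?P xs) ?v \<le> 1 / 2 ^ ?k - 1 / poly r (real n)" .
    moreover have "measure_pmf.prob (result ?P xs) {b. b \<noteq> ?v} = 1 - pmf (result ?P xs) ?v"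
    proof -
      have "{b. b \<noteq> ?v} = space (measure_pmf (result ?P xs)) - {?v}" by auto
      then show ?thesis
        by (simp only: measure_pmf.prob_compl[of "{?v}" "result ?P xs"] measure_pmf_single sets_measure_pmf UNIV_I)
    qed
    ultimately show ?thesis
      using length_avoid by (auto simp: res)
  qed
  with compare_prog_correct(1)[OF B(1) A_polytime] r_pos show ?thesis
    unfolding randomized_membership_comparable_def by blast
qed

end
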